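(* Let $f$ be a transcendental entire function, let $K(f)=\{z\in\mathbb{C} : (f^n(z))_{n\in\mathbb{N}}\text{ is bounded}\}$ and let $J(f)$ be its Julia set. (a) Either $K(f)\cap J(f)$ is connected, or else every neighbourhood of every point of $J(f)$ meets uncountably many components of $K(f)\cap J(f)$. (b) If $f$ is strongly polynomial-like, then either $K(f)$ is connected, or else every neighbourhood of every point of $J(f)$ meets uncountably many components of $K(f)$.
   Context: $f^n$ denotes the $n$th iterate of $f$. The Fatou set $F(f)$ is the set of $z\in\mathbb{C}$ such that $\{f^n\}$ is normal on some neighbourhood of $z$, and $J(f)=\mathbb{C}\setminus F(f)$. A polynomial-like mapping $(f;V,W)$ consists of bounded simply connected domains $V,W$ with smooth boundaries such that $\overline V\subset W$, and $f:V\to W$ is a proper analytic map of degree $d\ge 2$. A transcendental entire function $f$ is strongly polynomial-like if there exist sequences $(V_n),(W_n)$ of bounded simply connected domains with smooth boundaries such that $V_n\subset V_{n+1}$, $W_n\subset W_{n+1}$ for all $n\in\mathbb{N}$, $\bigcup_n V_n=\bigcup_n W_n=\mathbb{C}$, and each $(f;V_n,W_n)$ is a polynomial-like mapping. *)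

theory Defs
  imports "HOL-Complex_Analysis.Complex_Analysis"
begin

definition transcendental_entire :: "(complex \<Rightarrow> complex) \<Rightarrow> bool" where
  "transcendental_entire f \<longleftrightarrow> f holomorphic_on UNIV \<and> \<not> (\<exists>p. \<forall>z. f z = poly p z)"

definition normal_family :: "(complex \<Rightarrow> complex) set \<Rightarrow> complex set \<Rightarrow> bool" where
  "normal_family F U \<longleftrightarrow>
     (\<forall>g :: nat \<Rightarrow> complex \<Rightarrow> complex. (\<forall>k. g k \<in> F) \<longrightarrow>
        (\<exists>r. strict_mono r \<and>
           ((\<exists>h. \<forall>K. compact K \<and> K \<subseteq> U \<longrightarrow> uniform_limit K (\<lambda>k. g (r k)) h sequentially) \<or>
            (\<forall>K. compact K \<and> K \<subseteq> U \<longrightarrow>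
               (\<forall>M. eventually (\<lambda>k. \<forall>z\<in>K. M \<le> norm (g (r k) z)) sequentially)))))"

definition fatou_set :: "(complex \<Rightarrow> complex) \<Rightarrow> complex set" where
  "fatou_set f = {z. \<exists>U. open U \<and> z \<in> U \<and> normal_family (range (\<lambda>n. f ^^ n)) U}"

definition julia_set :: "(complex \<Rightarrow> complex) \<Rightarrow> complex set" where
  "julia_set f = UNIV - fatou_set f"

definition bounded_orbit_set :: "(complex \<Rightarrow> complex) \<Rightarrow> complex set" where
  "bounded_orbit_set f = {z. bounded (range (\<lambda>n. (f ^^ n) z))}"

definition smooth_jordan_curve :: "(real \<Rightarrow> complex) \<Rightarrow> bool" where
  "smooth_jordan_curve \<gamma> \<longleftrightarrow>
     (\<exists>D :: nat \<Rightarrow> real \<Rightarrow> complex. D 0 = \<gamma> \<and>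
        (\<forall>k t. (D k has_vector_derivative D (Suc k) t) (at t)) \<and>
        (\<forall>t. D 1 t \<noteq> 0)) \<and>
     (\<forall>t. \<gamma> (t + 1) = \<gamma> t) \<and> inj_on \<gamma> {0..<1}"

definition smooth_boundary :: "complex set \<Rightarrow> bool" where
  "smooth_boundary V \<longleftrightarrow> (\<exists>\<gamma>. smooth_jordan_curve \<gamma> \<and> frontier V = \<gamma> ` {0..1})"

definition bounded_sc_smooth_domain :: "complex set \<Rightarrow> bool" where
  "bounded_sc_smooth_domain V \<longleftrightarrow>
     open V \<and> connected V \<and> bounded V \<and> simply_connected V \<and> smooth_boundary V"

definition proper_analytic_degree ::
    "(complex \<Rightarrow> complex) \<Rightarrow> complex set \<Rightarrow> complex set \<Rightarrow> nat \<Rightarrow> bool" where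
  "proper_analytic_degree f V W d \<longleftrightarrow>
     f holomorphic_on V \<and> f ` V \<subseteq> W \<and>
     (\<forall>K. compact K \<and> K \<subseteq> W \<longrightarrow> compact (V \<inter> f -` K)) \<and>
     (\<forall>w\<in>W. finite (V \<inter> f -` {w}) \<and>
        (\<Sum>z\<in>V \<inter> f -` {w}. zorder (\<lambda>x. f x - w) z) = int d)"

definition polynomial_like :: "(complex \<Rightarrow> complex) \<Rightarrow> complex set \<Rightarrow> complex set \<Rightarrow> bool" where
  "polynomial_like f V W \<longleftrightarrow>
     bounded_sc_smooth_domain V \<and> bounded_sc_smooth_domain W \<and> closure V \<subseteq> W \<and>
     (\<exists>d\<ge>2. proper_analytic_degree f V W d)"

definition strongly_polynomial_like :: "(complex \<Rightarrow> complex) \<Rightarrow> bool" where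
  "strongly_polynomial_like f \<longleftrightarrow> transcendental_entire f \<and>
     (\<exists>V W :: nat \<Rightarrow> complex set.
        (\<forall>n. V n \<subseteq> V (Suc n) \<and> W n \<subseteq> W (Suc n)) \<and>
        (\<Union>n. V n) = UNIV \<and> (\<Union>n. W n) = UNIV \<and>
        (\<forall>n. polynomial_like f (V n) (W n)))"

end

theory Submission
  imports Defs
begin

text \<open>Let \<open>E\<close> be \<open>K(f) \<inter> J(f)\<close> or \<open>K(f)\<close>, and suppose that disjoint relatively open sets \<open>E \<inter> G\<^sub>0\<close>,
  \<open>E \<inter> G\<^sub>1\<close> disconnect \<open>E\<close> and both meet \<open>J(f)\<close>. Take small closed discs in \<open>G\<^sub>0\<close> and \<open>G\<^sub>1\<close> around
  nonexceptional points of \<open>J(f)\<close>, and let \<open>X\<^sub>0\<close>, \<open>X\<^sub>1\<close> be their intersections with \<open>J(f)\<close>. By Montel's theorem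
  some iterate of \<open>f\<close> maps each \<open>X\<^sub>i\<close> over \<open>X\<^sub>0 \<union> X\<^sub>1\<close>, and some iterate maps \<open>U \<inter> J(f)\<close> over \<open>X\<^sub>0 \<union> X\<^sub>1\<close>
  for any open \<open>U\<close> meeting \<open>J(f)\<close>. Hence every 0-1 sequence is the itinerary of a point of \<open>U\<close> with
  bounded orbit in \<open>J(f)\<close>. Since \<open>f(E) \<subseteq> E\<close>, the iterates of a component of \<open>E\<close> never cross between \<open>G\<^sub>0\<close>
  and \<open>G\<^sub>1\<close>, so different itineraries belong to different components.

  For \<open>E = K(f)\<close> it remains to see that both pieces meet \<open>J(f)\<close>. If \<open>K(f) \<inter> G\<^sub>i\<close> did not, its points whose
  orbits stay in a suitable \<open>V\<^sub>n\<close> would form a nonempty, compact and open subset of the plane: compact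
  because \<open>f : V\<^sub>n \<rightarrow> W\<^sub>n\<close> is proper, open because of normality.\<close>

section \<open>Normal sequences\<close>

text \<open>The second alternative is convergence to \<infinity>, uniform on compact sets. The
  definition isolates the part of \<open>normal_family\<close> that does not involve the choice of a
  subsequence.\<close>

definition normally_convergent :: "(nat \<Rightarrow> complex \<Rightarrow> complex) \<Rightarrow> complex set \<Rightarrow> bool" where
  "normally_convergent g U \<longleftrightarrow>
     (\<exists>h. \<forall>K. compact K \<and> K \<subseteq> U \<longrightarrow> uniform_limit K g h sequentially) \<or>
     (\<forall>K. compact K \<and> K \<subseteq> U \<longrightarrow>
        (\<forall>M. eventually (\<lambda>k. \<forall>z\<in>K. M \<le> norm (g k z)) sequentially))"

lemma normally_convergentI_finite:
  assumes "\<And>K. \<lbrakk>compact K; K \<subseteq> U\<rbrakk> \<Longrightarrow> uniform_limit K g h sequentially"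
  shows "normally_convergent g U"
  using assms unfolding normally_convergent_def by blast

lemma normally_convergentI_infinite:
  assumes "\<And>K M. \<lbrakk>compact K; K \<subseteq> U\<rbrakk> \<Longrightarrow> \<forall>\<^sub>F k in sequentially. \<forall>z\<in>K. M \<le> norm (g k z)"
  shows "normally_convergent g U"
  using assms unfolding normally_convergent_def by blast

lemma normally_convergentE:
  assumes "normally_convergent g U"
  obtains (finite) h where
      "\<And>K. \<lbrakk>compact K; K \<subseteq> U\<rbrakk> \<Longrightarrow> uniform_limit K g h sequentially"
    | (infinite)
      "\<And>K M. \<lbrakk>compact K; K \<subseteq> U\<rbrakk> \<Longrightarrow> \<forall>\<^sub>F k in sequentially. \<forall>z\<in>K. M \<le> norm (g k z)"
  using assms unfolding normally_convergent_def by blast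

lemma normal_family_iff:
  "normal_family F U \<longleftrightarrow>
     (\<forall>g :: nat \<Rightarrow> complex \<Rightarrow> complex. (\<forall>k. g k \<in> F) \<longrightarrow> (\<exists>r :: nat \<Rightarrow> nat. strict_mono r \<and> normally_convergent (\<lambda>k. g (r k)) U))"
  by (simp only: normal_family_def normally_convergent_def)

lemma normally_convergent_subseq:
  assumes "normally_convergent g U" "strict_mono r"
  shows "normally_convergent (\<lambda>k. g (r k)) U"
proof -
  have ev: "eventually (\<lambda>k. P (r k)) sequentially" if "eventually P sequentially" for P
    by (rule eventually_subseq[OF assms(2) that])
  have ul: "uniform_limit K (\<lambda>k. g (r k)) h sequentially" if "uniform_limit K g h sequentially" for K h
    using that unfolding uniform_limit_iff by (auto intro!: ev)
  from assms(1) show ?thesis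
  proof (cases rule: normally_convergentE)
    case (finite h)
    show ?thesis by (rule normally_convergentI_finite[of _ _ h]) (intro ul finite)
  next
    case infinite
    show ?thesis by (rule normally_convergentI_infinite) (intro ev infinite)
  qed
qed

text \<open>This undoes a normalisation that moves two varying omitted values to 0 and 1. Continuity
  makes the finite limit bounded on compact sets, as a uniform limit of products requires;
  \<open>\<gamma> \<noteq> 0\<close> preserves divergence to \<infinity>.\<close>

lemma normally_convergent_affine:
  fixes a c :: "nat \<Rightarrow> complex"
  assumes h: "normally_convergent h S"
    and cont: "\<And>k. continuous_on S (h k)"
    and a: "a \<longlonglongrightarrow> \<alpha>" and c: "c \<longlonglongrightarrow> \<gamma>" and \<gamma>: "\<gamma> \<noteq> 0"
  shows "normally_convergent (\<lambda>k z. a k + c k * h k z) S"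
  using h
proof (cases rule: normally_convergentE)
  case (finite l)
  have const: "uniform_limit K (\<lambda>k z. x k) (\<lambda>z. y) sequentially"
    if "x \<longlonglongrightarrow> y" for K :: "complex set" and x :: "nat \<Rightarrow> complex" and y
    using tendstoD[OF that] unfolding uniform_limit_iff by (auto elim: eventually_mono)
  have "uniform_limit K (\<lambda>k z. a k + c k * h k z) (\<lambda>z. \<alpha> + \<gamma> * l z) sequentially"
    if K: "compact K" "K \<subseteq> S" for K
  proof (intro uniform_limit_intros uniform_lim_mult const a c)
    show ul: "uniform_limit K h l sequentially"
      using finite K by blast
    show "bounded (l ` K)"
    proof (rule uniform_limit_bounded[OF ul])
      show "\<forall>\<^sub>F i in sequentially. bounded (h i ` K)"
        by (intro always_eventually allI compact_imp_bounded compact_continuous_image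
            continuous_on_subset[OF cont]) (use K in auto)
    qed simp
  qed (auto simp: image_constant_conv)
  then show ?thesis by (rule normally_convergentI_finite)
next
  case infinite
  have "\<forall>\<^sub>F k in sequentially. \<forall>z\<in>K. M \<le> cmod (a k + c k * h k z)"
    if K: "compact K" "K \<subseteq> S" for K M
  proof -
    have 1: "\<forall>\<^sub>F k in sequentially. cmod (a k) < cmod \<alpha> + 1"
      using order_tendstoD(2)[OF tendsto_norm[OF a]] by simp
    have 2: "\<forall>\<^sub>F k in sequentially. cmod \<gamma> / 2 < cmod (c k)"
      by (rule order_tendstoD(1)[OF tendsto_norm[OF c]]) (use \<gamma> in simp)
    \<comment> \<open>The threshold is chosen so that \<open>c k * h k z\<close> has modulus at
      least \<open>\<bar>M\<bar> + cmod \<alpha> + 1\<close>, while \<open>a k\<close> eventually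
      has modulus below \<open>cmod \<alpha> + 1\<close>.\<close>
    have 3: "\<forall>\<^sub>F k in sequentially. \<forall>z\<in>K. (\<bar>M\<bar> + cmod \<alpha> + 1) / (cmod \<gamma> / 2) \<le> cmod (h k z)"
      using infinite K by blast
    from 1 2 3 show ?thesis
    proof eventually_elim
      case (elim k)
      show ?case
      proof
        fix z assume "z \<in> K"
        then have h3: "(\<bar>M\<bar> + cmod \<alpha> + 1) / (cmod \<gamma> / 2) \<le> cmod (h k z)"
          using elim(3) by blast
        have "\<bar>M\<bar> + cmod \<alpha> + 1 = (cmod \<gamma> / 2) * ((\<bar>M\<bar> + cmod \<alpha> + 1) / (cmod \<gamma> / 2))"
          using \<gamma> by simp
        also have "\<dots> \<le> cmod (c k) * cmod (h k z)"
          using elim(2) h3 by (intro mult_mono) auto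
        also have "\<dots> = cmod (c k * h k z)"
          by (simp add: norm_mult)
        also have "\<dots> \<le> cmod (a k + c k * h k z) + cmod (a k)"
          by (metis add_diff_cancel_left' norm_triangle_ineq4)
        finally show "M \<le> cmod (a k + c k * h k z)"
          using elim(1) by linarith
      qed
    qed
  qed
  then show ?thesis by (rule normally_convergentI_infinite)
qed

section \<open>Montel's theorem for functions omitting two values\<close>

lemma Montel_bounded_at_point:
  fixes g :: "nat \<Rightarrow> complex \<Rightarrow> complex"
  assumes S: "open S" "connected S" "w \<in> S"
    and hol: "\<And>k. g k holomorphic_on S"
    and omit: "\<And>k z. z \<in> S \<Longrightarrow> g k z \<noteq> 0 \<and> g k z \<noteq> 1"
    and bd: "\<And>k. norm (g k w) \<le> 1"
  obtains h r where "h holomorphic_on S" "strict_mono (r :: nat \<Rightarrow> nat)"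
    "\<And>K. \<lbrakk>compact K; K \<subseteq> S\<rbrakk> \<Longrightarrow> uniform_limit K (\<lambda>k. g (r k)) h sequentially"
proof (rule Montel[of S "range g" g])
  \<comment> \<open>Schottky's theorem: for functions omitting 0 and 1, a bound at the single point
    \<open>w\<close> spreads to a uniform bound on each compact subset of \<open>S\<close>. The
    version of Montel's theorem for locally bounded families then applies.\<close>
  show "\<exists>B. \<forall>h\<in>range g. \<forall>z\<in>K. cmod (h z) \<le> B" if K: "compact K" "K \<subseteq> S" for K
  proof -
    show ?thesis
    proof (rule GPicard3[of S w "range g" "range g" K])
      fix B assume "\<And>h z. \<lbrakk>h \<in> range g; z \<in> K\<rbrakk> \<Longrightarrow> norm (h z) \<le> B"
      then show ?thesis by blast
    qed (use S K hol omit bd in auto)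
  qed
qed (use S hol that in \<open>auto simp: o_def\<close>)

text \<open>Either infinitely many \<open>g k\<close> have modulus at most 1 at a fixed point, or
  infinitely many have modulus above 1 there. In the second case the reciprocals, which also omit 0
  and 1, have a convergent subsequence; a limit without zeros gives a finite limit of the original
  functions, and the limit 0 gives divergence to \<infinity>.\<close>

lemma normally_convergent_subseq_omitting_01:
  fixes g :: "nat \<Rightarrow> complex \<Rightarrow> complex"
  assumes S: "open S" "connected S" "S \<noteq> {}"
    and hol: "\<And>k. g k holomorphic_on S"
    and omit: "\<And>k z. z \<in> S \<Longrightarrow> g k z \<noteq> 0 \<and> g k z \<noteq> 1"
  shows "\<exists>r. strict_mono r \<and> normally_convergent (\<lambda>k. g (r k)) S"
proof -
  obtain w where w: "w \<in> S" using S by blast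
  show ?thesis
  proof (cases "finite {k. norm (g k w) \<le> 1}")
    case False
    then obtain s :: "nat \<Rightarrow> nat" where s: "strict_mono s"
      and "\<forall>n. s n \<in> {k. norm (g k w) \<le> 1}"
      using infinite_enumerate[OF False] by blast
    then have s1: "norm (g (s n) w) \<le> 1" for n by simp
    obtain h r where r: "strict_mono (r :: nat \<Rightarrow> nat)"
      and ul: "\<And>K. \<lbrakk>compact K; K \<subseteq> S\<rbrakk> \<Longrightarrow> uniform_limit K (\<lambda>k. g (s (r k))) h sequentially"
      by (rule Montel_bounded_at_point[of S w "\<lambda>k. g (s k)"]) (use S w hol omit s1 in auto)
    show ?thesis
      using normally_convergentI_finite[OF ul] strict_mono_o[OF s r]
      by (intro exI[of _ "s \<circ> r"]) simp
  next
    case True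
    have "- {k. norm (g k w) \<le> 1} = {k. norm (g k w) > 1}" by auto
    with True have "infinite {k. norm (g k w) > 1}"
      by (metis infinite_UNIV_nat finite_compl)
    then obtain s :: "nat \<Rightarrow> nat" where s: "strict_mono s"
      and "\<forall>n. s n \<in> {k. norm (g k w) > 1}"
      using infinite_enumerate by blast
    then have s1: "norm (g (s n) w) > 1" for n by simp
    have i1: "norm (inverse (g (s k) w)) \<le> 1" for k
      using s1[of k] by (simp add: norm_inverse inverse_le_1_iff)
    have i2: "(\<lambda>z. inverse (g (s k) z)) holomorphic_on S" for k
      using hol omit by (intro holomorphic_on_inverse) auto
    have i3: "inverse (g (s k) z) \<noteq> 0 \<and> inverse (g (s k) z) \<noteq> 1" if "z \<in> S" for k z
      using omit[OF that, of "s k"] by simp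
    obtain h r where hh: "h holomorphic_on S" and r: "strict_mono (r :: nat \<Rightarrow> nat)"
      and ul: "\<And>K. \<lbrakk>compact K; K \<subseteq> S\<rbrakk> \<Longrightarrow>
            uniform_limit K (\<lambda>k z. inverse (g (s (r k)) z)) h sequentially"
      by (rule Montel_bounded_at_point[of S w "\<lambda>k z. inverse (g (s k) z)"])
        (use S w i1 i2 i3 in auto)
    \<comment> \<open>Hurwitz's theorem: a nonconstant limit of zero-free functions is
      zero-free.\<close>
    have "(\<forall>z\<in>S. h z \<noteq> 0) \<or> (\<forall>z\<in>S. h z = 0)"
    proof (cases "h constant_on S")
      case True then show ?thesis unfolding constant_on_def by auto
    next
      case False
      have "h z \<noteq> 0" if "z \<in> S" for z
      proof (rule Hurwitz_no_zeros[of S "\<lambda>k z. inverse (g (s (r k)) z)" h])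
        show "uniform_limit K (\<lambda>k z. inverse (g (s (r k)) z)) h sequentially"
          if "compact K" "K \<subseteq> S" for K by (rule ul) fact+
        show "inverse (g (s (r k)) z) \<noteq> 0" if "z \<in> S" for k z using i3[OF that] by simp
      qed (use S i2 hh False that in simp_all)
      then show ?thesis by blast
    qed
    then have "normally_convergent (\<lambda>k. g (s (r k))) S"
    proof
      assume nz: "\<forall>z\<in>S. h z \<noteq> 0"
      have "uniform_limit K (\<lambda>k. g (s (r k))) (inverse \<circ> h) sequentially"
        if K: "compact K" "K \<subseteq> S" for K
      proof -
        \<comment> \<open>A positive lower bound for the limit is what allows inverting a uniform
          limit.\<close>
        have "\<exists>b>0. \<forall>z\<in>K. b \<le> norm (h z)"
        proof (cases "K = {}")
          case True then show ?thesis by (intro exI[of _ 1]) auto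
        next
          case False
          have "continuous_on K (\<lambda>z. norm (h z))"
            using K hh by (intro continuous_intros holomorphic_on_imp_continuous_on)
              (blast intro: holomorphic_on_subset)
          then obtain x where "x \<in> K" "\<forall>z\<in>K. norm (h x) \<le> norm (h z)"
            using continuous_attains_inf[OF K(1) False] by blast
          then show ?thesis using nz K by (intro exI[of _ "norm (h x)"]) auto
        qed
        then obtain b where "b > 0" "\<And>z. z \<in> K \<Longrightarrow> b \<le> norm (h z)" by blast
        from uniform_lim_inverse[OF ul[OF K] this(2,1)] show ?thesis by simp
      qed
      then show ?thesis by (rule normally_convergentI_finite)
    next
      assume z: "\<forall>z\<in>S. h z = 0"
      have "\<forall>\<^sub>F k in sequentially. \<forall>z\<in>K. M \<le> cmod (g (s (r k)) z)"
        if K: "compact K" "K \<subseteq> S" for K M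
      proof -
        have "\<forall>\<^sub>F k in sequentially. \<forall>z\<in>K. dist (inverse (g (s (r k)) z)) (h z) < inverse (\<bar>M\<bar> + 1)"
          using ul[OF K] by (rule uniform_limitD) (simp add: add_nonneg_pos)
        then show ?thesis
        proof eventually_elim
          case (elim k)
          show ?case
          proof
            fix x assume x: "x \<in> K"
            then have "inverse (cmod (g (s (r k)) x)) < inverse (\<bar>M\<bar> + 1)"
              using elim z K by (auto simp: dist_norm norm_inverse subset_iff)
            moreover have "cmod (g (s (r k)) x) > 0" using omit x K by auto
            ultimately have "\<bar>M\<bar> + 1 < cmod (g (s (r k)) x)"
              using inverse_less_imp_less by blast
            then show "M \<le> cmod (g (s (r k)) x)" by linarith
          qed
        qed
      qed
      then show ?thesis by (rule normally_convergentI_infinite)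
    qed
    then show ?thesis
      by (intro exI[of _ "s \<circ> r"]) (use strict_mono_o[OF s r] in auto)
  qed
qed

text \<open>The omitted values may vary with \<open>k\<close>: by compactness they converge along a
  subsequence, and disjointness of \<open>A\<close> and \<open>B\<close> keeps their limits apart.
  An affine change of the target then reduces to the omitted values 0 and 1.\<close>

lemma normally_convergent_subseq_omitting:
  fixes g :: "nat \<Rightarrow> complex \<Rightarrow> complex"
  assumes S: "open S" "connected S" "S \<noteq> {}"
    and hol: "\<And>k. g k holomorphic_on S"
    and omit: "\<And>k z. z \<in> S \<Longrightarrow> g k z \<noteq> a k \<and> g k z \<noteq> b k"
    and A: "compact A" "\<And>k. a k \<in> A" and B: "compact B" "\<And>k. b k \<in> B" and AB: "A \<inter> B = {}"
  shows "\<exists>r. strict_mono r \<and> normally_convergent (\<lambda>k. g (r k)) S"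
proof -
  have ab: "b k \<noteq> a k" for k using A(2)[of k] B(2)[of k] AB by auto
  have "compact (A \<times> B)" using A B by (simp add: compact_Times)
  moreover have "\<forall>k. (a k, b k) \<in> A \<times> B" using A B by simp
  ultimately obtain l s where l: "l \<in> A \<times> B" and s: "strict_mono (s :: nat \<Rightarrow> nat)"
    and lim: "((\<lambda>k. (a k, b k)) \<circ> s) \<longlonglongrightarrow> l"
    unfolding compact_def by meson
  have la: "(\<lambda>k. a (s k)) \<longlonglongrightarrow> fst l" and lb: "(\<lambda>k. b (s k)) \<longlonglongrightarrow> snd l"
    using tendsto_fst[OF lim] tendsto_snd[OF lim] by (simp_all add: o_def)
  have ne: "snd l - fst l \<noteq> 0" using l AB by auto
  define h where "h = (\<lambda>k z. (g (s k) z - a (s k)) / (b (s k) - a (s k)))"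
  have holh: "h k holomorphic_on S" for k
    unfolding h_def using ab[of "s k"] hol by (intro holomorphic_intros) auto
  have "h k z \<noteq> 0 \<and> h k z \<noteq> 1" if "z \<in> S" for k z
  proof -
    have "g (s k) z - a (s k) \<noteq> b (s k) - a (s k)" "g (s k) z - a (s k) \<noteq> 0"
      using omit[OF that, of "s k"] by auto
    then show ?thesis using ab[of "s k"] by (simp add: h_def)
  qed
  then obtain r where r: "strict_mono r" "normally_convergent (\<lambda>k. h (r k)) S"
    using normally_convergent_subseq_omitting_01[of S h] S holh by blast
  have "normally_convergent (\<lambda>k z. a (s (r k)) + (b (s (r k)) - a (s (r k))) * h (r k) z) S"
  proof (rule normally_convergent_affine)
    show "continuous_on S (h (r k))" for k
      using holh holomorphic_on_imp_continuous_on by blast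
    show "(\<lambda>k. a (s (r k))) \<longlonglongrightarrow> fst l"
      using LIMSEQ_subseq_LIMSEQ[OF la r(1)] by (simp add: o_def)
    show "(\<lambda>k. b (s (r k)) - a (s (r k))) \<longlonglongrightarrow> snd l - fst l"
      using LIMSEQ_subseq_LIMSEQ[OF tendsto_diff[OF lb la] r(1)] by (simp add: o_def)
  qed (fact r ne)+
  moreover have "a (s (r k)) + (b (s (r k)) - a (s (r k))) * h (r k) z = g (s (r k)) z" for k z
    using ab[of "s (r k)"] by (simp add: h_def)
  ultimately have "normally_convergent (\<lambda>k. g ((s \<circ> r) k)) S"
    by (simp add: o_def)
  then show ?thesis using strict_mono_o[OF s r(1)] by blast
qed

section \<open>Entire functions and their Julia sets\<close>

lemma holomorphic_on_funpow:
  assumes "f holomorphic_on UNIV"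
  shows "(f ^^ n) holomorphic_on UNIV"
proof (induction n)
  case 0
  then show ?case by (simp add: id_def)
next
  case (Suc n)
  show ?case
    using holomorphic_on_compose_gen[OF Suc assms] by (simp add: o_def)
qed

lemma transcendental_entire_imp_nonconstant:
  assumes "transcendental_entire f"
  shows "\<not> f constant_on UNIV"
proof
  assume "f constant_on UNIV"
  then obtain c where "\<And>z. f z = poly [:c:] z"
    unfolding constant_on_def by auto
  then show False
    using assms unfolding transcendental_entire_def by blast
qed

text \<open>Great Picard at 0 for \<open>f \<circ> inverse\<close>. The singularity is essential: a
  finite limit of \<open>f\<close> at \<infinity> would make \<open>f\<close> constant by Liouville,
  and a limit of \<open>1/f\<close> there would make it a polynomial.\<close>

lemma transcendental_entire_Picard:
  assumes f: "transcendental_entire f"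
  obtains e where "\<And>w. w \<noteq> e \<Longrightarrow> infinite (f -` {w})"
proof (rule great_Picard_infinite[of UNIV 0 "f \<circ> inverse"])
  have hol: "f holomorphic_on UNIV" and np: "\<not> (\<exists>p. \<forall>z. f z = poly p z)"
    using f unfolding transcendental_entire_def by auto
  show "f \<circ> inverse holomorphic_on UNIV - {0}"
    by (rule holomorphic_on_compose_gen[OF _ hol]) (auto intro!: holomorphic_intros)
  show "\<not> (f \<circ> inverse) \<midarrow>0\<rightarrow> l" for l
  proof
    assume "(f \<circ> inverse) \<midarrow>0\<rightarrow> l"
    then have "(f \<longlongrightarrow> l) at_infinity" by (simp add: lim_at_infinity_0)
    then have "f z = l" for z using Liouville_weak[OF hol] by blast
    then have "\<forall>z. f z = poly [:l:] z" by simp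
    then show False using np by blast
  qed
  show "\<not> (inverse \<circ> (f \<circ> inverse)) \<midarrow>0\<rightarrow> l" for l
  proof
    assume "(inverse \<circ> (f \<circ> inverse)) \<midarrow>0\<rightarrow> l"
    then have "((inverse \<circ> f) \<longlongrightarrow> l) at_infinity" by (simp add: lim_at_infinity_0 o_assoc)
    then obtain a n where "\<And>z. f z = (\<Sum>i\<le>n. a i * z ^ i)"
      using pole_at_infinity[OF hol] by blast
    then have "\<forall>z. f z = poly (\<Sum>i\<le>n. monom (a i) i) z"
      by (simp add: poly_sum poly_monom)
    then show False using np by blast
  qed
  fix e assume e: "\<And>w. w \<noteq> e \<Longrightarrow> infinite {x \<in> UNIV - {0}. (f \<circ> inverse) x = w}"
  have "infinite (f -` {w})" if "w \<noteq> e" for w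
  proof
    assume "finite (f -` {w})"
    then have "finite (inverse ` (f -` {w}))" by simp
    moreover have "{x \<in> UNIV - {0}. (f \<circ> inverse) x = w} \<subseteq> inverse ` (f -` {w})"
      by (auto intro!: image_eqI[where x = "inverse x" for x])
    ultimately show False using e[OF that] finite_subset by blast
  qed
  then show thesis by (rule that)
qed auto

lemma open_entire_image:
  fixes f :: "complex \<Rightarrow> complex"
  assumes "f holomorphic_on UNIV" "\<not> f constant_on UNIV" "open U"
  shows "open (f ` U)"
  using open_mapping_thm[OF assms(1) open_UNIV connected_UNIV assms(3)] assms(2) by simp

section \<open>The Fatou set is open and completely invariant\<close>

lemma open_fatou_set: "open (fatou_set f)"
proof (subst open_subopen, safe)
  fix z assume "z \<in> fatou_set f"
  then obtain U where "open U" "z \<in> U" "normal_family (range (\<lambda>n. f ^^ n)) U"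
    unfolding fatou_set_def by auto
  then show "\<exists>T. open T \<and> z \<in> T \<and> T \<subseteq> fatou_set f"
    unfolding fatou_set_def by (intro exI[of _ U]) auto
qed

lemma closed_julia_set: "closed (julia_set f)"
  unfolding julia_set_def using open_fatou_set by (simp add: closed_Diff)

lemma fatou_setE:
  assumes "z \<in> fatou_set f"
  obtains U where "open U" "z \<in> U"
    "\<And>n :: nat \<Rightarrow> nat. \<exists>r. strict_mono r \<and> normally_convergent (\<lambda>k. f ^^ n (r k)) U"
proof -
  obtain U where U: "open U" "z \<in> U" and N: "normal_family (range (\<lambda>n. f ^^ n)) U"
    using assms unfolding fatou_set_def by auto
  show thesis
  proof (rule that[OF U])
    fix n :: "nat \<Rightarrow> nat"
    have "\<forall>k. f ^^ n k \<in> range (\<lambda>n. f ^^ n)" by simp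
    from N[unfolded normal_family_iff, rule_format, OF this[rule_format]]
    show "\<exists>r. strict_mono r \<and> normally_convergent (\<lambda>k. f ^^ n (r k)) U" .
  qed
qed

lemma fatou_setI:
  assumes U: "open U" "z \<in> U"
    and conv: "\<And>n :: nat \<Rightarrow> nat. \<exists>r. strict_mono r \<and> normally_convergent (\<lambda>k. f ^^ n (r k)) U"
  shows "z \<in> fatou_set f"
proof -
  have "normal_family (range (\<lambda>n. f ^^ n)) U"
    unfolding normal_family_iff
  proof (intro allI impI)
    fix g :: "nat \<Rightarrow> complex \<Rightarrow> complex" assume "\<forall>k. g k \<in> range (\<lambda>n. f ^^ n)"
    then have "\<forall>k. \<exists>n. g k = f ^^ n" by blast
    then obtain n where "\<And>k. g k = f ^^ n k" by metis
    then show "\<exists>r. strict_mono r \<and> normally_convergent (\<lambda>k. g (r k)) U"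
      using conv by simp
  qed
  with U show ?thesis unfolding fatou_set_def by blast
qed

text \<open>For \<open>n > 0\<close>, \<open>f^n\<close> is \<open>f^(n-1)\<close> after
  \<open>f\<close>, and \<open>f\<close> sends compact subsets of the preimage of \<open>U\<close>
  to compact subsets of \<open>U\<close>, so convergence pulls back.\<close>

lemma fatou_set_vimage:
  assumes cont: "continuous_on UNIV f" and "f z \<in> fatou_set f"
  shows "z \<in> fatou_set f"
proof -
  obtain U where U: "open U" "f z \<in> U"
    and N: "\<And>n :: nat \<Rightarrow> nat. \<exists>r. strict_mono r \<and> normally_convergent (\<lambda>k. f ^^ n (r k)) U"
    using fatou_setE[OF assms(2)] by metis
  show ?thesis
  proof (rule fatou_setI)
    show "open (f -` U)" using cont U by (simp add: open_vimage)
    show "z \<in> f -` U" using U by simp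
    fix n :: "nat \<Rightarrow> nat"
    show "\<exists>r. strict_mono r \<and> normally_convergent (\<lambda>k. f ^^ n (r k)) (f -` U)"
    \<comment> \<open>The index 0 cannot be lowered. If it occurs infinitely often, the identity is
      a constant subsequence; otherwise a subsequence has positive indices only.\<close>
    proof (cases "finite {k. n k = 0}")
      case False
      then obtain r :: "nat \<Rightarrow> nat" where r: "strict_mono r" "\<forall>k. r k \<in> {k. n k = 0}"
        using infinite_enumerate by blast
      have "uniform_limit K (\<lambda>k. f ^^ n (r k)) (\<lambda>z. z) sequentially" for K
        using r(2) by (simp add: uniform_limit_iff)
      then show ?thesis
        using r(1) normally_convergentI_finite by blast
    next
      case True
      have "- {k. n k = 0} = {k. n k > 0}" by auto
      with True have "infinite {k. n k > 0}" by (metis infinite_UNIV_nat finite_compl)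
      then obtain s :: "nat \<Rightarrow> nat" where s: "strict_mono s" "\<forall>k. s k \<in> {k. n k > 0}"
        using infinite_enumerate by blast
      obtain r where r: "strict_mono r" "normally_convergent (\<lambda>k. f ^^ (n (s (r k)) - 1)) U"
        using N[of "\<lambda>k. n (s k) - 1"] by blast
      have eq: "f ^^ n (s (r k)) = (\<lambda>x. (f ^^ (n (s (r k)) - 1)) (f x))" for k
        using s(2) funpow_Suc_right[of "n (s (r k)) - 1" f] by (auto simp: o_def)
      have cK: "compact (f ` K)" "f ` K \<subseteq> U" if "compact K" "K \<subseteq> f -` U" for K
        using that cont by (auto intro!: compact_continuous_image intro: continuous_on_subset)
      from r(2) have "normally_convergent (\<lambda>k. f ^^ n (s (r k))) (f -` U)"
      proof (cases rule: normally_convergentE)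
        case (finite h)
        show ?thesis
        proof (rule normally_convergentI_finite)
          fix K assume K: "compact K" "K \<subseteq> f -` U"
          show "uniform_limit K (\<lambda>k. f ^^ n (s (r k))) (\<lambda>x. h (f x)) sequentially"
            unfolding eq
            by (rule uniform_limit_compose'[OF finite[OF cK[OF K]]]) auto
        qed
      next
        case infinite
        show ?thesis
        proof (rule normally_convergentI_infinite)
          fix K M assume K: "compact K" "K \<subseteq> f -` U"
          show "\<forall>\<^sub>F k in sequentially. \<forall>z\<in>K. M \<le> cmod ((f ^^ n (s (r k))) z)"
            unfolding eq using infinite[OF cK[OF K], of M] by simp
        qed
      qed
      then show ?thesis
        using strict_mono_o[OF s(1) r(1)] by (intro exI[of _ "s \<circ> r"]) simp
    qed
  qed
qed

text \<open>On the open image of a small disc, \<open>f^n\<close> equals \<open>f^(n+1)\<close>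
  composed with a right inverse of \<open>f\<close>, so convergence of the iterates with raised
  index is transported forward.\<close>

lemma fatou_set_image:
  assumes f: "f holomorphic_on UNIV" "\<not> f constant_on UNIV" and "z \<in> fatou_set f"
  shows "f z \<in> fatou_set f"
proof -
  obtain U where U: "open U" "z \<in> U"
    and N: "\<And>n :: nat \<Rightarrow> nat. \<exists>r. strict_mono r \<and> normally_convergent (\<lambda>k. f ^^ n (r k)) U"
    using fatou_setE[OF assms(3)] by metis
  obtain e where e: "e > 0" "cball z e \<subseteq> U"
    using U open_contains_cball by blast
  show ?thesis
  proof (rule fatou_setI)
    show "open (f ` ball z e)" by (rule open_entire_image[OF f]) simp
    show "f z \<in> f ` ball z e" using e by simp
    fix n :: "nat \<Rightarrow> nat"
    obtain r where r: "strict_mono r" "normally_convergent (\<lambda>k. f ^^ Suc (n (r k))) U"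
      using N[of "\<lambda>k. Suc (n k)"] by blast
    \<comment> \<open>This right inverse may be discontinuous. That does no harm: its values lie in
      \<open>cball z e\<close>, where the convergence is already uniform.\<close>
    define c where "c = inv_into (ball z e) f"
    have c: "c y \<in> cball z e \<and> f (c y) = y" if "y \<in> f ` ball z e" for y
      using inv_into_into[OF that] f_inv_into_f[OF that] by (auto simp: c_def)
    have eq: "(f ^^ Suc (n (r k))) (c y) = (f ^^ n (r k)) y" if "y \<in> f ` ball z e" for k y
      using c[OF that] by (simp add: funpow_swap1)
    from r(2) have "normally_convergent (\<lambda>k. f ^^ n (r k)) (f ` ball z e)"
    proof (cases rule: normally_convergentE)
      case (finite h)
      show ?thesis
      proof (rule normally_convergentI_finite)
        fix K assume K: "compact K" "K \<subseteq> f ` ball z e"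
        have "uniform_limit K (\<lambda>k y. (f ^^ Suc (n (r k))) (c y)) (\<lambda>y. h (c y)) sequentially"
          by (rule uniform_limit_compose'[OF finite[OF compact_cball e(2)]]) (use c K in blast)
        then show "uniform_limit K (\<lambda>k. f ^^ n (r k)) (\<lambda>y. h (c y)) sequentially"
          by (rule uniform_limit_cong'[THEN iffD1, rotated -1]) (use eq K in auto)
      qed
    next
      case infinite
      show ?thesis
      proof (rule normally_convergentI_infinite)
        fix K M assume K: "compact K" "K \<subseteq> f ` ball z e"
        have "\<forall>\<^sub>F k in sequentially. \<forall>z\<in>cball z e. M \<le> cmod ((f ^^ Suc (n (r k))) z)"
          by (rule infinite[OF compact_cball e(2)])
        then show "\<forall>\<^sub>F k in sequentially. \<forall>z\<in>K. M \<le> cmod ((f ^^ n (r k)) z)"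
        proof eventually_elim
          case (elim k)
          show ?case
          proof
            fix y assume "y \<in> K"
            then have "y \<in> f ` ball z e" using K by blast
            then show "M \<le> cmod ((f ^^ n (r k)) y)" using elim c eq by metis
          qed
        qed
      qed
    qed
    then show "\<exists>r. strict_mono r \<and> normally_convergent (\<lambda>k. f ^^ n (r k)) (f ` ball z e)"
      using r(1) by blast
  qed
qed

lemma funpow_in_julia_set_iff:
  assumes f: "f holomorphic_on UNIV" "\<not> f constant_on UNIV"
  shows "(f ^^ n) z \<in> julia_set f \<longleftrightarrow> z \<in> julia_set f"
proof (induction n)
  case (Suc n)
  have "f w \<in> julia_set f \<longleftrightarrow> w \<in> julia_set f" for w
    using fatou_set_image[OF f] fatou_set_vimage[of f] holomorphic_on_imp_continuous_on[OF f(1)]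
    unfolding julia_set_def by blast
  then show ?case using Suc by simp
qed simp

text \<open>If \<open>f\<^sup>n\<^sup>+\<^sup>1\<close> omits \<open>w\<close> on a disc then \<open>f\<^sup>n\<close> omits all preimages of \<open>w\<close>, so that a sequence of
  iterates without normally convergent subsequence cannot keep missing points of \<open>K\<close>.\<close>

lemma julia_set_blow_up:
  assumes f: "f holomorphic_on UNIV" "\<not> f constant_on UNIV"
    and z: "z \<in> julia_set f" and U: "open U" "z \<in> U"
    and K: "compact K" "\<And>w. w \<in> K \<Longrightarrow> \<exists>a b. a \<noteq> b \<and> f a = w \<and> f b = w"
  obtains m where "m > 0" "K \<subseteq> (f ^^ m) ` U"
proof -
  obtain e where e: "e > 0" "ball z e \<subseteq> U" using U openE by blast
  let ?S = "ball z e"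
  have "\<not> (\<forall>n :: nat \<Rightarrow> nat. \<exists>r. strict_mono r \<and> normally_convergent (\<lambda>k. f ^^ n (r k)) ?S)"
    using fatou_setI[of ?S z f] z e by (auto simp: julia_set_def)
  then obtain n :: "nat \<Rightarrow> nat"
    where n: "\<And>r. strict_mono r \<Longrightarrow> \<not> normally_convergent (\<lambda>k. f ^^ n (r k)) ?S"
    by blast
  have "\<exists>k. K \<subseteq> (f ^^ Suc (n k)) ` ?S"
  proof (rule ccontr)
    assume "\<nexists>k. K \<subseteq> (f ^^ Suc (n k)) ` ?S"
    then have "\<forall>k. \<exists>w. w \<in> K \<and> w \<notin> (f ^^ Suc (n k)) ` ?S" by blast
    then obtain w where wK: "\<And>k. w k \<in> K" and w: "\<And>k. w k \<notin> (f ^^ Suc (n k)) ` ?S" by metis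
    obtain \<omega> s where \<omega>: "\<omega> \<in> K" and s: "strict_mono (s :: nat \<Rightarrow> nat)" and lim: "(w \<circ> s) \<longlonglongrightarrow> \<omega>"
      using K(1) wK unfolding compact_def by metis
    \<comment> \<open>Two preimages of the limit point yield two separated omitted values. Since
      \<open>f\<close> is open, \<open>w (s k)\<close> eventually has preimages \<open>x k\<close>
      and \<open>y k\<close> near \<open>a\<close> and \<open>b\<close>; the radius, a third of
      \<open>dist a b\<close>, keeps the two closed discs disjoint.\<close>
    obtain a b where ab: "a \<noteq> b" "f a = \<omega>" "f b = \<omega>" using K(2)[OF \<omega>] by blast
    define \<delta> where "\<delta> = dist a b / 3"
    have \<delta>: "\<delta> > 0" using ab by (simp add: \<delta>_def)
    have ev: "\<forall>\<^sub>F k in sequentially. (w \<circ> s) k \<in> f ` ball c \<delta>" if "f c = \<omega>" for c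
      by (rule topological_tendstoD[OF lim open_entire_image[OF f open_ball]])
        (use that \<delta> in auto)
    obtain N where N: "\<And>k. k \<ge> N \<Longrightarrow> (w \<circ> s) k \<in> f ` ball a \<delta> \<and> (w \<circ> s) k \<in> f ` ball b \<delta>"
      using eventually_conj[OF ev[OF ab(2)] ev[OF ab(3)]] unfolding eventually_sequentially by blast
    have "\<forall>k. \<exists>x y. x \<in> ball a \<delta> \<and> f x = w (s (k + N)) \<and> y \<in> ball b \<delta> \<and> f y = w (s (k + N))"
    proof
      fix k
      have "(w \<circ> s) (k + N) \<in> f ` ball a \<delta> \<and> (w \<circ> s) (k + N) \<in> f ` ball b \<delta>"
        by (rule N) simp
      then show "\<exists>x y. x \<in> ball a \<delta> \<and> f x = w (s (k + N)) \<and> y \<in> ball b \<delta> \<and> f y = w (s (k + N))"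
        unfolding o_def by (metis imageE)
    qed
    then obtain x y where x: "\<And>k. x k \<in> ball a \<delta>" "\<And>k. f (x k) = w (s (k + N))"
      and y: "\<And>k. y k \<in> ball b \<delta>" "\<And>k. f (y k) = w (s (k + N))"
      by metis
    have "\<exists>r. strict_mono r \<and> normally_convergent (\<lambda>k. f ^^ n (s (r k + N))) ?S"
    proof (rule normally_convergent_subseq_omitting[where a = x and b = y
          and A = "cball a \<delta>" and B = "cball b \<delta>"])
      show "f ^^ n (s (k + N)) holomorphic_on ?S" for k
        by (rule holomorphic_on_subset[OF holomorphic_on_funpow[OF f(1)]]) simp
      show "(f ^^ n (s (k + N))) v \<noteq> x k \<and> (f ^^ n (s (k + N))) v \<noteq> y k" if "v \<in> ?S" for k v
      proof -
        have "f ((f ^^ n (s (k + N))) v) \<noteq> w (s (k + N))"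
        proof
          assume "f ((f ^^ n (s (k + N))) v) = w (s (k + N))"
          then have "w (s (k + N)) = (f ^^ Suc (n (s (k + N)))) v" by simp
          then show False using w[of "s (k + N)"] that by blast
        qed
        then show ?thesis using x y by metis
      qed
      show "x k \<in> cball a \<delta>" "y k \<in> cball b \<delta>" for k
        using x y ball_subset_cball by blast+
      have "\<not> (dist a v \<le> \<delta> \<and> dist b v \<le> \<delta>)" for v
        using dist_triangle[of a b v] \<delta> dist_commute[of v b] unfolding \<delta>_def by linarith
      then show "cball a \<delta> \<inter> cball b \<delta> = {}" by auto
    qed (use e in auto)
    then obtain r where r: "strict_mono r" "normally_convergent (\<lambda>k. f ^^ n (s (r k + N))) ?S"
      by blast
    have "strict_mono (\<lambda>k. s (r k + N))"
      using r(1) s by (simp add: strict_mono_def)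
    then show False using n r(2) by blast
  qed
  then obtain k where "K \<subseteq> (f ^^ Suc (n k)) ` ?S" by blast
  then show thesis
    using e by (intro that[of "Suc (n k)"]) auto
qed

lemma infinite_vimageD:
  assumes "infinite (f -` {w})"
  shows "\<exists>a b. a \<noteq> b \<and> f a = w \<and> f b = w"
proof -
  obtain a where "a \<in> f -` {w}" using assms by (metis ex_in_conv finite.emptyI)
  moreover have "infinite (f -` {w} - {a})" using assms by simp
  then obtain b where "b \<in> f -` {w} - {a}" by (metis ex_in_conv finite.emptyI)
  ultimately show ?thesis by auto
qed

text \<open>Some \<open>v \<noteq> e\<close> in the Julia set has two distinct preimages
  \<open>p\<close>, \<open>q\<close> other than \<open>e\<close>. Both have infinitely many
  preimages themselves, so an iterate of \<open>U\<close> covers \<open>{p, q}\<close>; the points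
  of \<open>U\<close> mapped to them are distinct, and one of them is not \<open>e\<close>.\<close>

lemma julia_set_avoid_point:
  assumes f: "f holomorphic_on UNIV" "\<not> f constant_on UNIV"
    and e: "\<And>w. w \<noteq> e \<Longrightarrow> infinite (f -` {w})"
    and xy: "x \<in> julia_set f" "y \<in> julia_set f" "x \<noteq> y"
    and U: "open U" "U \<inter> julia_set f \<noteq> {}"
  obtains z where "z \<in> U" "z \<in> julia_set f" "z \<noteq> e"
proof -
  obtain u where u: "u \<in> U" "u \<in> julia_set f" using U by blast
  obtain v where v: "v \<in> julia_set f" "v \<noteq> e" using xy by metis
  have J: "f z \<in> julia_set f \<longleftrightarrow> z \<in> julia_set f" for z
    using funpow_in_julia_set_iff[OF f, of 1] by simp
  have "infinite (f -` {v} - {e})" using e[OF v(2)] by simp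
  then obtain p where p: "p \<in> f -` {v} - {e}" by (metis ex_in_conv finite.emptyI)
  have "infinite (f -` {v} - {e} - {p})" using \<open>infinite (f -` {v} - {e})\<close> by simp
  then obtain q where q: "q \<in> f -` {v} - {e} - {p}" by (metis ex_in_conv finite.emptyI)
  obtain m where m: "{p, q} \<subseteq> (f ^^ m) ` U"
    by (rule julia_set_blow_up[OF f u(2) U(1) u(1), of "{p, q}"]) (use p q infinite_vimageD[OF e] in auto)
  then obtain p' q' where pq: "p' \<in> U" "q' \<in> U" "(f ^^ m) p' = p" "(f ^^ m) q' = q" by auto
  have "p \<in> julia_set f" "q \<in> julia_set f" using J[of p] J[of q] p q v by auto
  then have "p' \<in> julia_set f" "q' \<in> julia_set f"
    using pq funpow_in_julia_set_iff[OF f, of m] by metis+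
  moreover have "p' \<noteq> q'" using pq p q by auto
  ultimately show thesis using that pq by metis
qed

section \<open>Horseshoes and components\<close>

text \<open>The map applied next depends on the current symbol, because the two pieces may need
  different numbers of iterations to cover both.\<close>

primrec itinerary_set ::
    "(bool \<Rightarrow> 'a \<Rightarrow> 'a) \<Rightarrow> (bool \<Rightarrow> 'a set) \<Rightarrow> nat \<Rightarrow> (nat \<Rightarrow> bool) \<Rightarrow> 'a set" where
  "itinerary_set F X 0 s = X (s 0)"
| "itinerary_set F X (Suc n) s = X (s 0) \<inter> F (s 0) -` itinerary_set F X n (\<lambda>k. s (Suc k))"

text \<open>Covering lets an admissible point be pulled back one step, so every finite itinerary is
  realised. The sets realising longer and longer prefixes are compact and nested, hence have a
  common point.\<close>

lemma horseshoe_itineraries: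
  fixes F :: "bool \<Rightarrow> 'a :: heine_borel \<Rightarrow> 'a"
  assumes X: "\<And>b. compact (X b)" "\<And>b. X b \<noteq> {}"
    and F: "\<And>b. continuous_on UNIV (F b)" "\<And>a b. X a \<subseteq> F b ` X b"
  obtains Y where "\<And>s. Y s \<noteq> {}" "\<And>s. Y s \<subseteq> X (s 0)"
    "\<And>s. F (s 0) ` Y s \<subseteq> Y (\<lambda>k. s (Suc k))"
proof -
  let ?P = "itinerary_set F X"
  have sub: "?P n s \<subseteq> X (s 0)" for n s by (cases n) auto
  have closed: "closed (?P n s)" for n s
  proof (induction n arbitrary: s)
    case (Suc n)
    show ?case unfolding itinerary_set.simps
      by (intro closed_Int closed_vimage compact_imp_closed X F(1) Suc)
  qed (simp add: X compact_imp_closed)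
  have compact: "compact (?P n s)" for n s
    using compact_Int_closed[OF X(1) closed] sub by (metis inf.absorb2)
  have ne: "?P n s \<noteq> {}" for n s
  proof (induction n arbitrary: s)
    case (Suc n)
    obtain y where y: "y \<in> ?P n (\<lambda>k. s (Suc k))" using Suc by blast
    then have "y \<in> F (s 0) ` X (s 0)" using sub F(2) by blast
    then show ?case using y by auto
  qed (simp add: X)
  have decr: "?P (Suc n) s \<subseteq> ?P n s" for n s
  proof (induction n arbitrary: s)
    case (Suc n)
    show ?case using Suc[of "\<lambda>k. s (Suc k)"] by auto
  qed simp
  then have "?P n s \<subseteq> ?P m s" if "m \<le> n" for m n s
    using lift_Suc_antimono_le[of "\<lambda>n. ?P n s", OF _ that] by blast
  then have "(\<Inter>n. ?P n s) \<noteq> {}" for s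
    using compact_nest[of "\<lambda>n. ?P n s"] compact ne by blast
  moreover have "(\<Inter>n. ?P n s) \<subseteq> X (s 0)" for s using sub by blast
  moreover have "F (s 0) ` (\<Inter>n. ?P n s) \<subseteq> (\<Inter>n. ?P n (\<lambda>k. s (Suc k)))" for s
  proof safe
    fix x n assume "x \<in> (\<Inter>n. ?P n s)"
    then have "x \<in> ?P (Suc n) s" by blast
    then show "F (s 0) x \<in> ?P n (\<lambda>k. s (Suc k))" by simp
  qed
  ultimately show thesis by (rule that[of "\<lambda>s. \<Inter>n. ?P n s"])
qed

section \<open>Symbol sequences and components\<close>

lemma uncountable_UNIV_nat_bool: "uncountable (UNIV :: (nat \<Rightarrow> bool) set)"
proof
  assume c: "countable (UNIV :: (nat \<Rightarrow> bool) set)"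
  define d where "d = (\<lambda>n. \<not> from_nat_into (UNIV :: (nat \<Rightarrow> bool) set) n n)"
  have "range (from_nat_into (UNIV :: (nat \<Rightarrow> bool) set)) = UNIV"
    using c by (intro range_from_nat_into) auto
  then obtain n where "d = from_nat_into UNIV n" by (metis rangeE UNIV_I)
  then show False by (metis d_def)
qed

lemma continuous_on_funpow:
  fixes f :: "'a :: topological_space \<Rightarrow> 'a"
  assumes "continuous_on UNIV f"
  shows "continuous_on UNIV (f ^^ n)"
proof (induction n)
  case 0
  show ?case by (simp add: id_def)
next
  case (Suc n)
  then show ?case
    using continuous_on_compose[OF Suc continuous_on_subset[OF assms]] by (simp add: o_def)
qed

lemma funpow_image_subset: "f ` E \<subseteq> E \<Longrightarrow> (f ^^ n) ` E \<subseteq> E"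
  by (induction n) auto

text \<open>A connected subset of \<open>E\<close> stays on one side of the separation \<open>G\<close> under all iterates, so
  points of one component of \<open>E\<close> have the same itinerary.\<close>

lemma uncountable_components_horseshoe:
  fixes f :: "'a :: heine_borel \<Rightarrow> 'a"
  assumes cont: "continuous_on UNIV f" and E: "f ` E \<subseteq> E"
    and G: "\<And>b. open (G b)" "E \<subseteq> G True \<union> G False" "G True \<inter> G False \<inter> E = {}"
    and X: "\<And>b. compact (X b)" "\<And>b. X b \<noteq> {}" "\<And>b. X b \<subseteq> G b"
    and m: "\<And>b. m b > 0" "\<And>a b. X a \<subseteq> (f ^^ m b) ` X b"
    and Z: "Z \<subseteq> U" "\<And>b. X b \<subseteq> (f ^^ l) ` Z"
    and bounded_E: "\<And>x. \<lbrakk>x \<in> Z; bounded (range (\<lambda>n. (f ^^ n) x))\<rbrakk> \<Longrightarrow> x \<in> E"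
  shows "uncountable {C \<in> components E. C \<inter> U \<noteq> {}}"
proof -
  have contn: "continuous_on A (f ^^ n)" for A n
    using continuous_on_funpow[OF cont] continuous_on_subset by blast
  obtain Y where Y: "\<And>s. Y s \<noteq> {}" "\<And>s. Y s \<subseteq> X (s 0)"
    "\<And>s. (f ^^ m (s 0)) ` Y s \<subseteq> Y (\<lambda>k. s (Suc k))"
    using horseshoe_itineraries[of X "\<lambda>b. f ^^ m b"] X(1,2) contn m(2) by metis
  \<comment> \<open>The intermediate iterates between successive visits to the sets
    \<open>X b\<close> are collected too, so that \<open>B\<close> contains whole orbits under
    \<open>f\<close>.\<close>
  define B where "B = (\<Union>b. \<Union>j<m b. (f ^^ j) ` X b)"
  have "compact B"
    unfolding B_def using X(1) by (intro compact_UN finite compact_continuous_image contn) auto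
  \<comment> \<open>Strong induction removes one block of \<open>m (s 0)\<close> iterations at a
    time; \<open>m b > 0\<close> makes the remaining time smaller.\<close>
  have orbit: "(f ^^ k) x \<in> B" if "x \<in> Y s" for k s x
    using that
  proof (induction k arbitrary: x s rule: less_induct)
    case (less k)
    have xX: "x \<in> X (s 0)" using Y(2) less.prems by blast
    show ?case
    proof (cases "k < m (s 0)")
      case True
      then show ?thesis using xX unfolding B_def by blast
    next
      case False
      have "(f ^^ (k - m (s 0))) ((f ^^ m (s 0)) x) \<in> B"
        by (rule less.IH[where s = "\<lambda>k. s (Suc k)"])
          (use m(1)[of "s 0"] False Y(3) less.prems in auto)
      moreover have "(f ^^ (k - m (s 0))) ((f ^^ m (s 0)) x) = (f ^^ k) x"
        using False by (metis comp_apply funpow_add le_add_diff_inverse2 not_less)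
      ultimately show ?thesis by simp
    qed
  qed
  have "\<exists>x\<in>Z. (f ^^ l) x \<in> Y s" for s
    using Y(1,2)[of s] Z(2)[of "s 0"] by blast
  then obtain p where p: "\<And>s. p s \<in> Z" "\<And>s. (f ^^ l) (p s) \<in> Y s" by metis
  have pE: "p s \<in> E" for s
  proof (rule bounded_E[OF p(1)])
    have "(f ^^ n) (p s) \<in> (\<lambda>n. (f ^^ n) (p s)) ` {..<l} \<union> B" for n
    proof (cases "n < l")
      case False
      have "(f ^^ (n - l)) ((f ^^ l) (p s)) = (f ^^ n) (p s)"
        using False by (metis comp_apply funpow_add le_add_diff_inverse2 not_less)
      then show ?thesis using orbit[OF p(2)[of s], of "n - l"] by simp
    qed auto
    then have "range (\<lambda>n. (f ^^ n) (p s)) \<subseteq> (\<lambda>n. (f ^^ n) (p s)) ` {..<l} \<union> B" by blast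
    moreover have "bounded ((\<lambda>n. (f ^^ n) (p s)) ` {..<l} \<union> B)"
      using compact_imp_bounded[OF \<open>compact B\<close>] by (simp add: finite_imp_bounded)
    ultimately show "bounded (range (\<lambda>n. (f ^^ n) (p s)))" by (rule bounded_subset[rotated])
  qed
  \<comment> \<open>The first symbols agree because \<open>C\<close> cannot meet both sides. Hence
    the same iterate shifts both sequences, and the induction continues with the connected image of
    \<open>C\<close>.\<close>
  have same: "s n = t n"
    if "connected C" "C \<subseteq> E" "x \<in> C" "y \<in> C" "x \<in> Y s" "y \<in> Y t" for n s t x y C
    using that
  proof (induction n arbitrary: s t x y C)
    case 0
    have "x \<in> G (s 0)" "y \<in> G (t 0)" using 0 Y(2) X(3) by blast+
    moreover have "G True \<inter> C = {} \<or> G False \<inter> C = {}"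
      by (rule connectedD[OF 0(1) G(1) G(1)]) (use 0 G in auto)
    ultimately show ?case using 0 by (cases "s 0"; cases "t 0") auto
  next
    case (Suc n)
    have "s 0 = t 0"
    proof (rule ccontr)
      assume ne: "s 0 \<noteq> t 0"
      have "x \<in> G (s 0)" "y \<in> G (t 0)" using Suc.prems Y(2) X(3) by blast+
      moreover have "G True \<inter> C = {} \<or> G False \<inter> C = {}"
        by (rule connectedD[OF Suc.prems(1) G(1) G(1)]) (use Suc.prems G in auto)
      ultimately show False using Suc.prems ne by (cases "s 0"; cases "t 0") auto
    qed
    let ?g = "f ^^ m (s 0)"
    have "(\<lambda>k. s (Suc k)) n = (\<lambda>k. t (Suc k)) n"
    proof (rule Suc.IH)
      show "connected (?g ` C)" by (rule connected_continuous_image[OF contn Suc.prems(1)])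
      show "?g ` C \<subseteq> E" using funpow_image_subset[OF E] Suc.prems(2) by blast
      show "?g x \<in> Y (\<lambda>k. s (Suc k))" using Y(3) Suc.prems(5) by blast
      show "?g y \<in> Y (\<lambda>k. t (Suc k))" using Y(3)[of t] Suc.prems(6) \<open>s 0 = t 0\<close> by auto
    qed (use Suc.prems in auto)
    then show ?case by simp
  qed
  define c where "c s = connected_component_set E (p s)" for s
  have "inj c"
  proof (rule injI, rule ext)
    fix s t n assume "c s = c t"
    then have "p s \<in> c s" "p t \<in> c s" using pE by (auto simp: c_def)
    show "s n = t n"
    proof (rule same[where x = "(f ^^ l) (p s)" and y = "(f ^^ l) (p t)"])
      show "connected ((f ^^ l) ` c s)"
        by (rule connected_continuous_image[OF contn]) (simp add: c_def)
      have "c s \<subseteq> E" by (simp add: c_def connected_component_subset)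
      then show "(f ^^ l) ` c s \<subseteq> E" using funpow_image_subset[OF E] by blast
    qed (use p \<open>p s \<in> c s\<close> \<open>p t \<in> c s\<close> in auto)
  qed
  moreover have "range c \<subseteq> {C \<in> components E. C \<inter> U \<noteq> {}}"
  proof safe
    fix s assume "c s \<inter> U = {}"
    moreover have "p s \<in> c s \<inter> U" using pE[of s] p(1)[of s] Z(1) by (auto simp: c_def)
    ultimately show False by simp
  qed (use pE in \<open>simp add: c_def componentsI\<close>)
  ultimately show ?thesis
    by (meson countable_image_inj_on countable_subset uncountable_UNIV_nat_bool
        countable_image_inj_eq)
qed

section \<open>Separations of the set of bounded orbits\<close>

lemma bounded_orbit_set_image: "f ` bounded_orbit_set f \<subseteq> bounded_orbit_set f"
proof safe
  fix z assume "z \<in> bounded_orbit_set f"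
  then have "bounded (range (\<lambda>n. (f ^^ n) z))" by (simp add: bounded_orbit_set_def)
  moreover have "(f ^^ n) (f z) = (f ^^ Suc n) z" for n by (simp add: funpow_swap1)
  then have "range (\<lambda>n. (f ^^ n) (f z)) \<subseteq> range (\<lambda>n. (f ^^ n) z)" by (metis image_subsetI rangeI)
  ultimately show "f z \<in> bounded_orbit_set f"
    unfolding bounded_orbit_set_def using bounded_subset by blast
qed

text \<open>The common core of both alternatives, used for the set of bounded orbits and for its
  intersection with the Julia set.\<close>

lemma uncountable_components_if_separated:
  assumes f: "transcendental_entire f"
    and E: "f ` E \<subseteq> E" "bounded_orbit_set f \<inter> julia_set f \<subseteq> E"
    and G: "\<And>b. open (G b)" "E \<subseteq> G True \<union> G False" "G True \<inter> G False \<inter> E = {}"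
    and GJ: "\<And>b. G b \<inter> julia_set f \<inter> E \<noteq> {}"
    and z: "z \<in> julia_set f" and U: "open U" "z \<in> U"
  shows "uncountable {C \<in> components E. C \<inter> U \<noteq> {}}"
proof -
  have hol: "f holomorphic_on UNIV" using f by (simp add: transcendental_entire_def)
  note f' = hol transcendental_entire_imp_nonconstant[OF f]
  obtain e where e: "\<And>w. w \<noteq> e \<Longrightarrow> infinite (f -` {w})"
    using transcendental_entire_Picard[OF f] by blast
  obtain x y where xy: "x \<in> julia_set f" "y \<in> julia_set f" "x \<noteq> y"
    using GJ[of True] GJ[of False] G(3) by blast
  \<comment> \<open>The discs avoid the Picard exceptional value \<open>e\<close>, so each of their
    points has two preimages, as \<open>julia_set_blow_up\<close> requires.\<close>
  have "\<exists>q \<rho>. q \<in> julia_set f \<and> \<rho> > 0 \<and> cball q \<rho> \<subseteq> G b - {e}" for b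
  proof -
    obtain q where q: "q \<in> G b" "q \<in> julia_set f" "q \<noteq> e"
      using julia_set_avoid_point[OF f' e xy G(1)[of b]] GJ[of b] by blast
    have "open (G b - {e})" "q \<in> G b - {e}" using q G(1) by (auto simp: open_delete)
    then show ?thesis using q open_contains_cball by blast
  qed
  then obtain q \<rho> where q: "\<And>b. q b \<in> julia_set f" "\<And>b. \<rho> b > 0"
    and sub: "\<And>b. cball (q b) (\<rho> b) \<subseteq> G b - {e}" by metis
  define X where "X b = cball (q b) (\<rho> b) \<inter> julia_set f" for b
  have X: "compact (X b)" "X b \<noteq> {}" "X b \<subseteq> G b" for b
  proof -
    show "compact (X b)" by (simp add: X_def compact_Int_closed closed_julia_set)
    have "q b \<in> X b" using q[of b] by (simp add: X_def)
    then show "X b \<noteq> {}" by blast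
    show "X b \<subseteq> G b" using sub[of b] by (auto simp: X_def)
  qed
  have blow: "\<exists>m>0. X True \<union> X False \<subseteq> (f ^^ m) ` (V \<inter> julia_set f)"
    if V: "open V" "v \<in> V" "v \<in> julia_set f" for V v
  proof -
    have "\<exists>a b. a \<noteq> b \<and> f a = w \<and> f b = w" if "w \<in> X True \<union> X False" for w
    proof (rule infinite_vimageD, rule e)
      show "w \<noteq> e" using that sub[of True] sub[of False] unfolding X_def by blast
    qed
    then obtain m where m: "m > 0" "X True \<union> X False \<subseteq> (f ^^ m) ` V"
      by (rule julia_set_blow_up[OF f' V(3,1,2) compact_Un[OF X(1) X(1)]])
    \<comment> \<open>By complete invariance, any preimage of a Julia point lies in the Julia set,
      so the covering persists after restriction to it.\<close>
    have "X True \<union> X False \<subseteq> julia_set f" by (auto simp: X_def)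
    then have "X True \<union> X False \<subseteq> (f ^^ m) ` (V \<inter> julia_set f)"
      using m(2) funpow_in_julia_set_iff[OF f', of m] by blast
    then show ?thesis using m(1) by blast
  qed
  have "\<exists>m>0. X True \<union> X False \<subseteq> (f ^^ m) ` X b" for b
  proof -
    obtain m where "m > 0" "X True \<union> X False \<subseteq> (f ^^ m) ` (ball (q b) (\<rho> b) \<inter> julia_set f)"
      using blow[of "ball (q b) (\<rho> b)" "q b"] q[of b] by auto
    moreover have "ball (q b) (\<rho> b) \<inter> julia_set f \<subseteq> X b" by (auto simp: X_def)
    ultimately show ?thesis by (meson image_mono subset_trans)
  qed
  then obtain m where m: "\<And>b. m b > 0" "\<And>b. X True \<union> X False \<subseteq> (f ^^ m b) ` X b" by metis
  have Xa: "X a \<subseteq> X True \<union> X False" for a by (cases a) auto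
  obtain m0 where m0: "X True \<union> X False \<subseteq> (f ^^ m0) ` (U \<inter> julia_set f)"
    using blow[OF U z] by blast
  show ?thesis
  proof (rule uncountable_components_horseshoe[where G = G and X = X and m = m and l = m0
        and Z = "U \<inter> julia_set f" and f = f])
    show "continuous_on UNIV f" by (rule holomorphic_on_imp_continuous_on[OF hol])
    show "X a \<subseteq> (f ^^ m b) ` X b" for a b using Xa m(2) by blast
    show "X a \<subseteq> (f ^^ m0) ` (U \<inter> julia_set f)" for a using Xa m0 by blast
    show "x \<in> E" if "x \<in> U \<inter> julia_set f" "bounded (range (\<lambda>n. (f ^^ n) x))" for x
      using that E(2) by (auto simp: bounded_orbit_set_def)
  qed (use E G X m in auto)
qed

section \<open>Compact sets of orbits staying in a polynomial-like domain\<close>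

lemma compact_polynomial_like_filled_julia_set:
  assumes V: "polynomial_like f V W" and cont: "continuous_on UNIV f"
  shows "compact {z. \<forall>k. (f ^^ k) z \<in> V}" (is "compact ?Q")
proof -
  have bV: "bounded V" and VW: "closure V \<subseteq> W"
    and proper: "\<And>K. \<lbrakk>compact K; K \<subseteq> W\<rbrakk> \<Longrightarrow> compact (V \<inter> f -` K)"
    using V unfolding polynomial_like_def bounded_sc_smooth_domain_def proper_analytic_degree_def
    by blast+
  \<comment> \<open>Points staying in the open set \<open>V\<close> also stay in \<open>?L\<close>,
    which is compact by properness since \<open>closure V \<subseteq> W\<close>. The open condition
    thus becomes a closed one.\<close>
  let ?L = "V \<inter> f -` closure V"
  have L: "compact ?L" using proper[of "closure V"] bV VW by (simp add: compact_closure)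
  have "?Q = (\<Inter>k. (f ^^ k) -` ?L)"
  proof (rule equalityI; rule subsetI)
    fix z assume z: "z \<in> ?Q"
    have "(f ^^ k) z \<in> V" "f ((f ^^ k) z) \<in> closure V" for k
    proof -
      have "(f ^^ Suc k) z \<in> V" "(f ^^ k) z \<in> V" using z by blast+
      then show "(f ^^ k) z \<in> V" "f ((f ^^ k) z) \<in> closure V"
        using closure_subset by auto
    qed
    then show "z \<in> (\<Inter>k. (f ^^ k) -` ?L)" by simp
  qed auto
  moreover have "closed (\<Inter>k. (f ^^ k) -` ?L)"
    using continuous_on_funpow[OF cont] compact_imp_closed[OF L]
    by (intro closed_INT ballI closed_vimage) auto
  moreover have "?Q \<subseteq> V"
  proof
    fix z assume "z \<in> ?Q"
    then have "(f ^^ 0) z \<in> V" by blast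
    then show "z \<in> V" by simp
  qed
  then have "bounded ?Q" using bV bounded_subset by blast
  ultimately show ?thesis by (simp add: compact_eq_bounded_closed)
qed

text \<open>Otherwise points tending to \<open>w\<close> leave \<open>V\<close> at times
  \<open>n j\<close>. A subsequence of these iterates converges near \<open>w\<close>; its limit is
  finite because the orbit of \<open>w\<close> is bounded. The limit at \<open>w\<close> lies in the
  closed set \<open>Q\<close>, hence inside \<open>V\<close>, and continuity of the limit forces the
  escaping points back into \<open>V\<close>.\<close>

lemma fatou_point_orbits_stay:
  assumes cont: "continuous_on UNIV f" and w: "w \<in> fatou_set f"
    and Q: "\<And>k. (f ^^ k) w \<in> Q" "compact Q" and V: "open V" "Q \<subseteq> V"
  obtains \<rho> where "\<rho> > 0" "\<And>x k. x \<in> ball w \<rho> \<Longrightarrow> (f ^^ k) x \<in> V"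
proof -
  obtain U where U: "open U" "w \<in> U"
    and N: "\<And>n :: nat \<Rightarrow> nat. \<exists>r. strict_mono r \<and> normally_convergent (\<lambda>k. f ^^ n (r k)) U"
    using fatou_setE[OF w] by metis
  obtain e where e: "e > 0" "cball w e \<subseteq> U" using U open_contains_cball by blast
  have "\<exists>\<rho>>0. \<forall>x k. x \<in> ball w \<rho> \<longrightarrow> (f ^^ k) x \<in> V"
  proof (rule ccontr)
    assume "\<not> (\<exists>\<rho>>0. \<forall>x k. x \<in> ball w \<rho> \<longrightarrow> (f ^^ k) x \<in> V)"
    then have "\<forall>j. \<exists>x k. x \<in> ball w (inverse (real (Suc j))) \<and> (f ^^ k) x \<notin> V"
      by (metis inverse_positive_iff_positive of_nat_0_less_iff zero_less_Suc)
    then obtain x n where x: "\<And>j. x j \<in> ball w (inverse (real (Suc j)))"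
      and nV: "\<And>j. (f ^^ n j) (x j) \<notin> V" by metis
    have "(\<lambda>j. dist (x j) w) \<longlonglongrightarrow> 0"
      by (rule tendsto_sandwich[OF _ _ tendsto_const LIMSEQ_inverse_real_of_nat])
        (use x in \<open>auto simp: dist_commute less_imp_le\<close>)
    then have xlim: "x \<longlonglongrightarrow> w" using tendsto_dist_iff by blast
    obtain r where r: "strict_mono r" and conv: "normally_convergent (\<lambda>k. f ^^ n (r k)) U"
      using N by blast
    have xr: "(\<lambda>j. x (r j)) \<longlonglongrightarrow> w" using LIMSEQ_subseq_LIMSEQ[OF xlim r] by (simp add: o_def)
    have xe: "\<forall>\<^sub>F j in sequentially. x (r j) \<in> cball w e"
      by (rule eventually_mono[OF tendstoD[OF xr e(1)]]) (simp add: dist_commute)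
    from conv show False
    proof (cases rule: normally_convergentE)
      case (finite h)
      have ul: "uniform_limit (cball w e) (\<lambda>k. f ^^ n (r k)) h sequentially"
        by (rule finite[OF compact_cball e(2)])
      have "continuous_on (cball w e) h"
        by (rule uniform_limit_theorem[OF always_eventually ul])
          (auto intro: continuous_on_subset[OF continuous_on_funpow[OF cont]])
      then have hlim: "(\<lambda>j. h (x (r j))) \<longlonglongrightarrow> h w"
        by (rule continuous_on_tendsto_compose[OF _ xr _ xe]) (use e in simp)
      have "(\<lambda>j. (f ^^ n (r j)) w) \<longlonglongrightarrow> h w"
        by (rule tendsto_uniform_limitI[OF ul]) (use e in simp)
      then have "h w \<in> Q"
        by (rule Lim_in_closed_set[OF compact_imp_closed[OF Q(2)] always_eventually[OF allI[OF Q(1)]]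
              sequentially_bot])
      then obtain d where d: "d > 0" "ball (h w) d \<subseteq> V" using V openE by blast
      have "\<forall>\<^sub>F j in sequentially. dist (h (x (r j))) (h w) < d / 2"
        by (rule tendstoD[OF hlim]) (use d in simp)
      moreover have "\<forall>\<^sub>F j in sequentially. \<forall>y\<in>cball w e. dist ((f ^^ n (r j)) y) (h y) < d / 2"
        by (rule uniform_limitD[OF ul]) (use d in simp)
      ultimately have "\<forall>\<^sub>F j in sequentially. False"
        using xe
      proof eventually_elim
        case (elim j)
        then have "dist ((f ^^ n (r j)) (x (r j))) (h (x (r j))) < d / 2" by blast
        then have "dist (h w) ((f ^^ n (r j)) (x (r j))) < d"
          using elim(1) by (metis dist_commute dist_triangle_half_r)
        then show False using d nV by auto
      qed
      then show False by simp
    next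
      case infinite
      obtain M where "\<And>y. y \<in> Q \<Longrightarrow> norm y \<le> M"
        using compact_imp_bounded[OF Q(2)] bounded_iff by metis
      then have "norm ((f ^^ n (r k)) w) \<le> M" for k using Q(1) by blast
      moreover have "\<forall>\<^sub>F k in sequentially. \<forall>z\<in>{w}. M + 1 \<le> cmod ((f ^^ n (r k)) z)"
        using infinite[of "{w}" "M + 1"] U by simp
      then obtain k where "M + 1 \<le> cmod ((f ^^ n (r k)) w)"
        by (auto simp: eventually_sequentially)
      ultimately show False by (smt (verit))
    qed
  qed
  then show thesis using that by blast
qed

lemma strongly_polynomial_like_separated_part:
  assumes f: "strongly_polynomial_like f"
    and G: "open G" "open H" "bounded_orbit_set f \<subseteq> G \<union> H" "G \<inter> H \<inter> bounded_orbit_set f = {}"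
    and ne: "G \<inter> bounded_orbit_set f \<noteq> {}"
  shows "G \<inter> julia_set f \<inter> bounded_orbit_set f \<noteq> {}"
proof
  assume empty: "G \<inter> julia_set f \<inter> bounded_orbit_set f = {}"
  have "f holomorphic_on UNIV"
    using f by (simp add: strongly_polynomial_like_def transcendental_entire_def)
  then have cont: "continuous_on UNIV f" by (rule holomorphic_on_imp_continuous_on)
  obtain V W where VW: "\<forall>n :: nat. V n \<subseteq> V (Suc n) \<and> W n \<subseteq> W (Suc n)"
    and cover: "(\<Union>n. V n) = UNIV" and "\<forall>n. polynomial_like f (V n) (W n)"
    using f unfolding strongly_polynomial_like_def by (elim conjE exE) (rule that)
  then have incr: "V n \<subseteq> V (Suc n)" and pl: "polynomial_like f (V n) (W n)" for n
    by simp_all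
  have oV: "open (V n)" and bV: "bounded (V n)" for n
    using pl[of n] unfolding polynomial_like_def bounded_sc_smooth_domain_def by auto
  obtain z where z: "z \<in> G" "z \<in> bounded_orbit_set f" using ne by blast
  \<comment> \<open>The closed orbit is compact and the increasing sets \<open>V n\<close> cover the
    plane, so a single \<open>V N\<close> contains it.\<close>
  let ?O = "closure (range (\<lambda>n. (f ^^ n) z))"
  have "compact ?O" using z(2) by (simp add: bounded_orbit_set_def compact_closure)
  moreover have "?O \<subseteq> (\<Union>n. V n)" by (simp only: cover subset_UNIV)
  ultimately obtain T where T: "finite T" "?O \<subseteq> (\<Union>n\<in>T. V n)"
    using oV by (elim compactE_image[of ?O UNIV V]) simp_all
  define N where "N = Max T"
  have N': "n \<le> N" if "n \<in> T" for n using Max_ge[OF T(1) that] by (simp add: N_def)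
  have "V n \<subseteq> V N" if "n \<in> T" for n using lift_Suc_mono_le[of V, OF incr N'[OF that]] .
  then have N: "?O \<subseteq> V N" using T(2) by blast
  let ?Q = "{z. \<forall>k. (f ^^ k) z \<in> V N}"
  have Qc: "compact ?Q" by (rule compact_polynomial_like_filled_julia_set[OF pl cont])
  have QV: "?Q \<subseteq> V N"
  proof
    fix z assume "z \<in> ?Q"
    then have "(f ^^ 0) z \<in> V N" by blast
    then show "z \<in> V N" by simp
  qed
  have QK: "?Q \<subseteq> bounded_orbit_set f"
  proof
    fix x assume "x \<in> ?Q"
    then have "range (\<lambda>n. (f ^^ n) x) \<subseteq> V N" by blast
    then show "x \<in> bounded_orbit_set f"
      using bounded_subset[OF bV[of N]] by (simp add: bounded_orbit_set_def)
  qed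
  let ?A = "?Q \<inter> G"
  \<comment> \<open>Removing the open set \<open>H\<close> instead of intersecting with
    \<open>G\<close> shows compactness.\<close>
  have "?A = ?Q - H" using QK G(3,4) by blast
  then have "compact ?A" using compact_diff[OF Qc G(2)] by simp
  have "open ?A"
  proof (subst open_subopen, intro ballI)
    fix w assume w: "w \<in> ?A"
    \<comment> \<open>By the assumption \<open>empty\<close>, points of \<open>?A\<close> are not in
      the Julia set, so a whole disc around \<open>w\<close> has orbits in
      \<open>V N\<close>.\<close>
    then have "w \<in> fatou_set f" using empty QK unfolding julia_set_def by blast
    moreover have "(f ^^ k) w \<in> ?Q" for k
    proof safe
      fix j
      have "(f ^^ (j + k)) w \<in> V N" using w by blast
      then show "(f ^^ j) ((f ^^ k) w) \<in> V N" by (simp add: funpow_add)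
    qed
    ultimately obtain \<rho> where "\<rho> > 0" "\<And>x k. x \<in> ball w \<rho> \<Longrightarrow> (f ^^ k) x \<in> V N"
      using fatou_point_orbits_stay[OF cont _ _ Qc oV QV] by metis
    then show "\<exists>T. open T \<and> w \<in> T \<and> T \<subseteq> ?A"
      using w G(1) by (intro exI[of _ "ball w \<rho> \<inter> G"]) auto
  qed
  moreover have "closed ?A" by (rule compact_imp_closed) fact
  moreover have "?A \<noteq> {}"
  proof -
    have "range (\<lambda>n. (f ^^ n) z) \<subseteq> V N" using closure_subset N by (rule subset_trans)
    then have "z \<in> ?A" using z(1) by blast
    then show ?thesis by blast
  qed
  \<comment> \<open>The plane is connected, so a nonempty clopen set is all of it, contradicting
    boundedness.\<close>
  ultimately have "?A = UNIV" using clopen[of ?A] by simp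
  moreover have "bounded ?A" by (rule compact_imp_bounded) fact
  ultimately show False using not_bounded_UNIV by metis
qed

text \<open>Indexing the two open sets by \<open>bool\<close> lets the symbols of an itinerary name
  the sides of the separation.\<close>

lemma not_connectedE:
  assumes "\<not> connected E"
  obtains G :: "bool \<Rightarrow> 'a :: topological_space set" where "\<And>b. open (G b)"
    "E \<subseteq> G True \<union> G False" "G True \<inter> G False \<inter> E = {}" "\<And>b. G b \<inter> E \<noteq> {}"
proof -
  obtain A B where "open A" "open B" "E \<subseteq> A \<union> B" "A \<inter> B \<inter> E = {}" "A \<inter> E \<noteq> {}" "B \<inter> E \<noteq> {}"
    using assms unfolding connected_def by blast
  then show thesis by (intro that[of "\<lambda>b. if b then A else B"]) auto
qed

theorem theorem1p3:
  fixes f :: "complex \<Rightarrow> complex"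
  assumes "transcendental_entire f"
  shows "(connected (bounded_orbit_set f \<inter> julia_set f) \<or>
          (\<forall>z\<in>julia_set f. \<forall>U. open U \<and> z \<in> U \<longrightarrow>
             uncountable {C \<in> components (bounded_orbit_set f \<inter> julia_set f). C \<inter> U \<noteq> {}}))
       \<and> (strongly_polynomial_like f \<longrightarrow>
          (connected (bounded_orbit_set f) \<or>
           (\<forall>z\<in>julia_set f. \<forall>U. open U \<and> z \<in> U \<longrightarrow>
             uncountable {C \<in> components (bounded_orbit_set f). C \<inter> U \<noteq> {}})))"
proof (intro conjI impI)
  have hol: "f holomorphic_on UNIV" using assms by (simp add: transcendental_entire_def)
  let ?E = "bounded_orbit_set f \<inter> julia_set f"
  have "f w \<in> julia_set f" if "w \<in> julia_set f" for w
    using funpow_in_julia_set_iff[OF hol transcendental_entire_imp_nonconstant[OF assms], of 1 w]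
      that by simp
  then have inv: "f ` ?E \<subseteq> ?E"
    using bounded_orbit_set_image by blast
  have "uncountable {C \<in> components ?E. C \<inter> U \<noteq> {}}"
    if "\<not> connected ?E" and zU: "z \<in> julia_set f" "open U" "z \<in> U" for z U
  proof -
    from that(1) obtain G where G: "\<And>b. open (G b)" "?E \<subseteq> G True \<union> G False"
      "G True \<inter> G False \<inter> ?E = {}" "\<And>b. G b \<inter> ?E \<noteq> {}"
      using not_connectedE by metis
    \<comment> \<open>Here both pieces lie in the Julia set, so nonemptiness of each is
      enough.\<close>
    show "uncountable {C \<in> components ?E. C \<inter> U \<noteq> {}}"
      by (rule uncountable_components_if_separated[OF assms inv _ G(1-3) _ zU]) (use G(4) in blast)+
  qed
  then show "connected ?E \<or> (\<forall>z\<in>julia_set f. \<forall>U. open U \<and> z \<in> U \<longrightarrow>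
      uncountable {C \<in> components ?E. C \<inter> U \<noteq> {}})" by blast
  assume spl: "strongly_polynomial_like f"
  let ?K = "bounded_orbit_set f"
  have "uncountable {C \<in> components ?K. C \<inter> U \<noteq> {}}"
    if "\<not> connected ?K" and zU: "z \<in> julia_set f" "open U" "z \<in> U" for z U
  proof -
    from that(1) obtain G where G: "\<And>b. open (G b)" "?K \<subseteq> G True \<union> G False"
      "G True \<inter> G False \<inter> ?K = {}" "\<And>b. G b \<inter> ?K \<noteq> {}"
      using not_connectedE by metis
    \<comment> \<open>The role of \<open>H\<close> is played by the opposite side
      \<open>G (\<not> b)\<close>.\<close>
    have "G b \<inter> julia_set f \<inter> ?K \<noteq> {}" for b
      by (rule strongly_polynomial_like_separated_part[OF spl G(1) G(1)[of "\<not> b"] _ _ G(4)])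
        (use G(2,3) in \<open>cases b; auto\<close>)+
    then show "uncountable {C \<in> components ?K. C \<inter> U \<noteq> {}}"
      by (intro uncountable_components_if_separated[OF assms bounded_orbit_set_image _ G(1-3) _ zU])
        auto
  qed
  then show "connected ?K \<or> (\<forall>z\<in>julia_set f. \<forall>U. open U \<and> z \<in> U \<longrightarrow>
      uncountable {C \<in> components ?K. C \<inter> U \<noteq> {}})" by blast
qed

end
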